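(* Let $\{\phi_i\}_{i\in I}$ and $\{\psi_i\}_{i\in I}$ be two frames for $\mathcal H$ that are $1$-woven. Then for all $\sigma\subset I$ and all $f\in\mathcal H$, $$\sum_{i\in\sigma}|\langle f,\phi_i\rangle|^2+\Big\|\sum_{i\in\sigma^c}\langle f,\psi_i\rangle\psi_i\Big\|^2=\sum_{i\in\sigma^c}|\langle f,\psi_i\rangle|^2+\Big\|\sum_{i\in\sigma}\langle f,\phi_i\rangle\phi_i\Big\|^2\ \ge\ \frac34\|f\|^2 .$$
   Context: $\mathcal H$ is a separable Hilbert space, $I$ is a countable index set, and for $\sigma\subset I$ one writes $\sigma^c=I\setminus\sigma$. A family $\{\phi_i\}_{i\in I}$ in $\mathcal H$ is a frame with lower and upper frame bounds $A,B>0$ if $A\|f\|^2\le\sum_{i\in I}|\langle f,\phi_i\rangle|^2\le B\|f\|^2$ for all $f\in\mathcal H$. Two frames $\{\phi_i\}_{i\in I}$ and $\{\psi_i\}_{i\in I}$ for $\mathcal H$ are woven if there are universal constants $A,B>0$ such that for every $\sigma\subset I$ the family $\{\phi_i\}_{i\in\sigma}\cup\{\psi_i\}_{i\in\sigma^c}$ (called a weaving) is a frame for $\mathcal H$ with lower and upper bounds $A$ and $B$. They are $1$-woven if this holds with $A=B=1$. *)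

theory Defs
  imports "HOL-Analysis.Analysis" "Jordan_Normal_Form.Conjugate"
begin

text \<open>
  Scalars of a Hilbert space: the real or the complex numbers. By the Gelfand--Mazur theorem every
  instance of \<^class>\<open>real_normed_field\<close> is, up to isometric isomorphism, one of these two, and the
  axiom below then forces \<^const>\<open>conjugate\<close> to be the usual conjugation.
\<close>

class hilbert_scalar = real_normed_field + conjugatable_field +
  assumes mult_conjugate: "x * conjugate x = (norm x)\<^sup>2 *\<^sub>R 1"

instance real :: hilbert_scalar
  by intro_classes (simp add: power2_eq_square)

instance complex :: hilbert_scalar
  by intro_classes (simp add: complex_norm_square scaleR_conv_of_real flip: of_real_power)

text \<open>
  The inner product is linear in its first argument and induces the norm of the type;
  completeness is part of \<^class>\<open>banach\<close>.
\<close>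

locale hilbert_space = vector_space scale
  for scale :: "'k::hilbert_scalar \<Rightarrow> 'a::banach \<Rightarrow> 'a" +
  fixes ip :: "'a \<Rightarrow> 'a \<Rightarrow> 'k"
  assumes scale_of_real: "scale (of_real r) x = r *\<^sub>R x"
    and ip_add_left: "ip (x + y) z = ip x z + ip y z"
    and ip_scale_left: "ip (scale c x) y = c * ip x y"
    and ip_conjugate: "ip x y = conjugate (ip y x)"
    and ip_self: "ip x x = of_real ((norm x)\<^sup>2)"

lemma hilbert_space_real_inner:
  "hilbert_space scaleR (inner :: 'a::{real_inner, banach} \<Rightarrow> 'a \<Rightarrow> real)"
  by unfold_locales
    (auto simp: inner_add_left inner_commute power2_norm_eq_inner algebra_simps)

lemma hilbert_space_complex: "hilbert_space (*) (\<lambda>x y :: complex. x * cnj y)"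
  by unfold_locales
    (auto simp: algebra_simps scaleR_conv_of_real complex_norm_square simp del: of_real_power)

text \<open>
  The real-valued \<^const>\<open>infsum\<close> of a divergent family is \<open>0\<close>, so the convergence that is implicit in
  the upper frame inequality is required explicitly.
\<close>

definition frame_with_bounds ::
    "('a::banach \<Rightarrow> 'a \<Rightarrow> 'k::hilbert_scalar) \<Rightarrow> 'i set \<Rightarrow> ('i \<Rightarrow> 'a) \<Rightarrow> real \<Rightarrow> real \<Rightarrow> bool"
  where "frame_with_bounds ip I \<phi> A B \<longleftrightarrow> A > 0 \<and> B > 0 \<and>
    (\<forall>f. (\<lambda>i. (norm (ip f (\<phi> i)))\<^sup>2) summable_on I \<and>
         A * (norm f)\<^sup>2 \<le> (\<Sum>\<^sub>\<infinity>i\<in>I. (norm (ip f (\<phi> i)))\<^sup>2) \<and>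
         (\<Sum>\<^sub>\<infinity>i\<in>I. (norm (ip f (\<phi> i)))\<^sup>2) \<le> B * (norm f)\<^sup>2)"

definition is_frame ::
    "('a::banach \<Rightarrow> 'a \<Rightarrow> 'k::hilbert_scalar) \<Rightarrow> 'i set \<Rightarrow> ('i \<Rightarrow> 'a) \<Rightarrow> bool"
  where "is_frame ip I \<phi> \<longleftrightarrow> (\<exists>A B. frame_with_bounds ip I \<phi> A B)"

text \<open>
  The union of the two subfamilies is one of indexed families (vectors count with multiplicity), so
  it is again a family indexed by \<open>I\<close>.
\<close>

definition weaving :: "'i set \<Rightarrow> ('i \<Rightarrow> 'a) \<Rightarrow> ('i \<Rightarrow> 'a) \<Rightarrow> 'i \<Rightarrow> 'a"
  where "weaving \<sigma> \<phi> \<psi> = (\<lambda>i. if i \<in> \<sigma> then \<phi> i else \<psi> i)"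

definition woven_with_bounds ::
    "('a::banach \<Rightarrow> 'a \<Rightarrow> 'k::hilbert_scalar) \<Rightarrow> 'i set \<Rightarrow> ('i \<Rightarrow> 'a) \<Rightarrow> ('i \<Rightarrow> 'a) \<Rightarrow> real \<Rightarrow> real \<Rightarrow> bool"
  where "woven_with_bounds ip I \<phi> \<psi> A B \<longleftrightarrow>
    (\<forall>\<sigma>\<subseteq>I. frame_with_bounds ip I (weaving \<sigma> \<phi> \<psi>) A B)"

abbreviation one_woven ::
    "('a::banach \<Rightarrow> 'a \<Rightarrow> 'k::hilbert_scalar) \<Rightarrow> 'i set \<Rightarrow> ('i \<Rightarrow> 'a) \<Rightarrow> ('i \<Rightarrow> 'a) \<Rightarrow> bool"
  where "one_woven ip I \<phi> \<psi> \<equiv> woven_with_bounds ip I \<phi> \<psi> 1 1"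

end

theory Submission
  imports Defs
begin

text \<open>
  Fix \<open>\<sigma>\<close> and let \<open>\<omega>\<close> be the corresponding weaving, a Parseval frame. Its partial
  sums \<open>S\<^sub>F f = (\<Sum>i\<in>F. \<langle>f, \<omega> i\<rangle> \<omega> i)\<close> satisfy
  \<open>\<parallel>S\<^sub>F f\<parallel>\<^sup>2 \<le> \<langle>S\<^sub>F f, f\<rangle>\<close> by the Bessel inequality, hence
  \<open>\<parallel>S\<^sub>F f - f\<parallel>\<^sup>2 \<le> \<parallel>f\<parallel>\<^sup>2 - \<langle>S\<^sub>F f, f\<rangle>\<close>, which tends to \<open>0\<close>: the expansion of \<open>f\<close> converges to \<open>f\<close>.
  So \<open>f = P + Q\<close> with \<open>P\<close> and \<open>Q\<close> the sums over \<open>\<sigma>\<close> and its complement. Put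
  \<open>a = \<langle>P, f\<rangle>\<close> and \<open>b = \<langle>Q, f\<rangle> = \<parallel>f\<parallel>\<^sup>2 - a\<close>, both real. Then
  \<open>a + \<parallel>f - P\<parallel>\<^sup>2 = \<parallel>f\<parallel>\<^sup>2 - a + \<parallel>P\<parallel>\<^sup>2 = b + \<parallel>P\<parallel>\<^sup>2\<close>, and since \<open>a \<le> \<parallel>P\<parallel> \<parallel>f\<parallel>\<close> this is at least
  \<open>\<parallel>f\<parallel>\<^sup>2 - \<parallel>P\<parallel> \<parallel>f\<parallel> + \<parallel>P\<parallel>\<^sup>2 \<ge> 3/4 \<parallel>f\<parallel>\<^sup>2\<close>.
\<close>

section \<open>Conjugation and norm of scalars\<close>

lemma norm_conjugate [simp]: "norm (conjugate x) = norm (x :: 'k::hilbert_scalar)"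
proof (cases "x = 0")
  case False
  have "norm (x * conjugate x) = (norm x)\<^sup>2"
    by (simp add: mult_conjugate)
  with False show ?thesis
    by (simp add: norm_mult power2_eq_square)
qed simp

lemma mult_conjugate_of_real: "x * conjugate x = of_real ((norm (x :: 'k::hilbert_scalar))\<^sup>2)"
  by (simp only: mult_conjugate of_real_def)

text \<open>The norm axiom turns r times its conjugate into r^2; for nonzero r, cancel one
  factor.\<close>

lemma conjugate_of_real [simp]: "conjugate (of_real r) = (of_real r :: 'k::hilbert_scalar)"
proof (cases "r = 0")
  case False
  have "of_real r * conjugate (of_real r :: 'k) = of_real r * of_real r"
    by (simp only: mult_conjugate_of_real) (simp add: power2_eq_square)
  with False show ?thesis by simp
qed simp

section \<open>Inner product calculus over abstract scalars\<close>

context hilbert_space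
begin

lemma ip_zero_left [simp]: "ip 0 y = 0"
  using ip_add_left[of 0 0 y] by simp

lemma ip_diff_left: "ip (x - y) z = ip x z - ip y z"
  using ip_add_left[of "x - y" y z] by simp

lemma ip_add_right: "ip x (y + z) = ip x y + ip x z"
  by (metis ip_conjugate ip_add_left conjugate_dist_add)

lemma ip_diff_right: "ip x (y - z) = ip x y - ip x z"
  using ip_add_right[of x "y - z" z] by simp

lemma ip_scale_right: "ip x (scale c y) = conjugate c * ip x y"
  by (metis ip_conjugate ip_scale_left conjugate_dist_mul)

lemma ip_sum_left: "ip (sum g F) y = (\<Sum>i\<in>F. ip (g i) y)"
  by (induction F rule: infinite_finite_induct) (auto simp: ip_add_left)

lemma norm_ip_commute: "norm (ip x y) = norm (ip y x)"
  by (metis ip_conjugate norm_conjugate)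

lemma mult_ip_swap: "ip x y * ip y x = of_real ((norm (ip x y))\<^sup>2)"
  by (metis ip_conjugate mult_conjugate_of_real)

lemma norm_ip_le: "norm (ip x y) \<le> norm x * norm y"
proof (cases "y = 0")
  case True
  then show ?thesis using norm_ip_commute[of x 0] by simp
next
  case False
  \<comment> \<open>\<open>scale c y\<close> is the orthogonal projection of \<open>x\<close> onto
    the line of \<open>y\<close>; orthogonality of the remainder to \<open>y\<close> makes the last
    bracket below vanish.\<close>
  define c :: 'k where "c = ip x y / of_real ((norm y)\<^sup>2)"
  have cy: "c * ip y y = ip x y"
    using False by (simp add: c_def ip_self)
  have "ip (x - scale c y) (x - scale c y)
      = ip x x - c * ip y x - conjugate c * (ip x y - c * ip y y)"
    by (simp add: ip_diff_left ip_diff_right ip_scale_left ip_scale_right algebra_simps)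
  also have "\<dots> = ip x x - ip x y * ip y x / of_real ((norm y)\<^sup>2)"
    by (simp only: cy) (simp add: c_def)
  also have "\<dots> = of_real ((norm x)\<^sup>2 - (norm (ip x y))\<^sup>2 / (norm y)\<^sup>2)"
    by (simp add: ip_self mult_ip_swap)
  finally have "(norm (x - scale c y))\<^sup>2 = (norm x)\<^sup>2 - (norm (ip x y))\<^sup>2 / (norm y)\<^sup>2"
    unfolding ip_self of_real_eq_iff .
  then have "0 \<le> (norm x)\<^sup>2 - (norm (ip x y))\<^sup>2 / (norm y)\<^sup>2"
    by (metis zero_le_power2)
  then have "(norm (ip x y))\<^sup>2 \<le> (norm x * norm y)\<^sup>2"
    using False by (simp add: field_simps)
  then show ?thesis
    by (rule power2_le_imp_le) simp
qed

lemma bounded_linear_ip: "bounded_linear (\<lambda>x. ip x y)"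
proof (rule bounded_linear_intro[where K = "norm y"])
  show "ip (r *\<^sub>R x) y = r *\<^sub>R ip x y" for r x
    using ip_scale_left[of "of_real r" x y] by (simp add: scale_of_real scaleR_conv_of_real)
qed (auto simp: ip_add_left norm_ip_le)

text \<open>A real inner product is symmetric, so both cross terms equal \<open>a\<close> and no
  real-part map on \<open>'k\<close> is needed.\<close>

lemma norm_diff_sq_ip_real:
  assumes "ip x y = of_real a"
  shows "(norm (x - y))\<^sup>2 = (norm x)\<^sup>2 - 2 * a + (norm y)\<^sup>2"
proof -
  have "ip y x = of_real a"
    using ip_conjugate[of y x] assms by simp
  then have "ip (x - y) (x - y) = of_real ((norm x)\<^sup>2 - 2 * a + (norm y)\<^sup>2)"
    by (simp only: ip_diff_left ip_diff_right assms) (simp add: ip_self)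
  then show ?thesis
    unfolding ip_self of_real_eq_iff .
qed

section \<open>Expansions in a Parseval frame\<close>

lemma ip_frame_term: "ip (scale (ip f x) x) f = of_real ((norm (ip f x))\<^sup>2)"
  by (simp only: ip_scale_left mult_ip_swap)

text \<open>Expand one argument of \<open>ip ?S ?S\<close> termwise, apply Cauchy-Schwarz to the
  finite sum, and use \<open>bessel\<close> at \<open>g = ?S\<close>; then cancel the square of
  \<open>norm ?S\<close> unless it is zero.\<close>

lemma norm_partial_sum_le:
  assumes bessel: "\<And>g. (\<Sum>i\<in>F. (norm (ip g (\<omega> i)))\<^sup>2) \<le> (norm g)\<^sup>2"
  shows "(norm (\<Sum>i\<in>F. scale (ip f (\<omega> i)) (\<omega> i)))\<^sup>2 \<le> (\<Sum>i\<in>F. (norm (ip f (\<omega> i)))\<^sup>2)"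
    (is "(norm ?S)\<^sup>2 \<le> ?A")
proof -
  have "(norm ?S)\<^sup>2 = norm (ip ?S ?S)"
    by (simp add: ip_self norm_power)
  also have "ip ?S ?S = (\<Sum>i\<in>F. ip f (\<omega> i) * ip (\<omega> i) ?S)"
    by (simp add: ip_sum_left[of _ _ ?S] ip_scale_left)
  also have "norm \<dots> \<le> (\<Sum>i\<in>F. norm (ip f (\<omega> i)) * norm (ip ?S (\<omega> i)))"
    by (rule sum_norm_le) (simp add: norm_mult norm_ip_commute)
  finally have "((norm ?S)\<^sup>2)\<^sup>2 \<le> (\<Sum>i\<in>F. norm (ip f (\<omega> i)) * norm (ip ?S (\<omega> i)))\<^sup>2"
    by (intro power_mono) auto
  also have "\<dots> \<le> ?A * (\<Sum>i\<in>F. (norm (ip ?S (\<omega> i)))\<^sup>2)"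
    by (rule Cauchy_Schwarz_ineq_sum)
  also have "\<dots> \<le> ?A * (norm ?S)\<^sup>2"
    by (intro mult_left_mono bessel sum_nonneg) auto
  finally have "(norm ?S)\<^sup>2 * (norm ?S)\<^sup>2 \<le> ?A * (norm ?S)\<^sup>2"
    by (simp only: power2_eq_square[of "(norm ?S)\<^sup>2"])
  then show ?thesis
  proof (cases "?S = 0")
    case False
    show ?thesis
      using \<open>(norm ?S)\<^sup>2 * (norm ?S)\<^sup>2 \<le> ?A * (norm ?S)\<^sup>2\<close>
      by (rule mult_right_le_imp_le) (use False in simp)
  qed (simp add: sum_nonneg)
qed

lemma parseval_expansion:
  assumes "frame_with_bounds ip I \<omega> 1 1"
  shows "((\<lambda>i. scale (ip f (\<omega> i)) (\<omega> i)) has_sum f) I"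
proof -
  define c where "c g i = (norm (ip g (\<omega> i)))\<^sup>2" for g i
  define S where "S = sum (\<lambda>i. scale (ip f (\<omega> i)) (\<omega> i))"
  have c: "c g summable_on I" "infsum (c g) I = (norm g)\<^sup>2" for g
    using assms by (simp_all add: frame_with_bounds_def c_def[abs_def] order_antisym)
  have bound: "norm (S F - f) \<le> sqrt ((norm f)\<^sup>2 - sum (c f) F)" if "finite F" "F \<subseteq> I" for F
  proof (rule real_le_rsqrt)
    \<comment> \<open>Nonnegative terms: a finite partial sum stays below the Parseval
      total.\<close>
    have "sum (c g) F \<le> (norm g)\<^sup>2" for g
      using finite_sum_le_infsum[OF c(1) that, of g] by (simp add: c) (simp add: c_def)
    then have "(norm (S F))\<^sup>2 \<le> sum (c f) F"
      unfolding c_def S_def by (rule norm_partial_sum_le)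
    moreover have "ip (S F) f = of_real (sum (c f) F)"
      by (simp only: S_def c_def ip_sum_left ip_frame_term of_real_sum)
    from norm_diff_sq_ip_real[OF this]
    have "(norm (S F - f))\<^sup>2 = (norm (S F))\<^sup>2 - 2 * sum (c f) F + (norm f)\<^sup>2" .
    ultimately show "(norm (S F - f))\<^sup>2 \<le> (norm f)\<^sup>2 - sum (c f) F"
      by linarith
  qed
  have "(sum (c f) \<longlongrightarrow> (norm f)\<^sup>2) (finite_subsets_at_top I)"
    using has_sum_infsum[OF c(1)] by (simp add: c has_sum_def)
  then have "((\<lambda>F. sqrt ((norm f)\<^sup>2 - sum (c f) F)) \<longlongrightarrow> sqrt ((norm f)\<^sup>2 - (norm f)\<^sup>2))
      (finite_subsets_at_top I)"
    by (intro tendsto_intros)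
  then have "((\<lambda>F. S F - f) \<longlongrightarrow> 0) (finite_subsets_at_top I)"
    by (intro Lim_null_comparison[OF eventually_finite_subsets_at_top_weakI[OF bound]]) auto
  then show ?thesis
    unfolding has_sum_def S_def[symmetric] by (rule LIM_zero_cancel)
qed

text \<open>Pairing with \<open>f\<close> is bounded and linear, hence commutes with the infinite
  sum.\<close>

lemma ip_infsum_frame_terms:
  assumes "(\<lambda>i. scale (ip f (\<omega> i)) (\<omega> i)) summable_on J"
    and "(\<lambda>i. (norm (ip f (\<omega> i)))\<^sup>2) summable_on J"
  shows "ip (\<Sum>\<^sub>\<infinity>i\<in>J. scale (ip f (\<omega> i)) (\<omega> i)) f = of_real (\<Sum>\<^sub>\<infinity>i\<in>J. (norm (ip f (\<omega> i)))\<^sup>2)"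
proof (rule has_sum_unique)
  show "((\<lambda>i. ip (scale (ip f (\<omega> i)) (\<omega> i)) f)
      has_sum ip (\<Sum>\<^sub>\<infinity>i\<in>J. scale (ip f (\<omega> i)) (\<omega> i)) f) J"
    using has_sum_bounded_linear[OF bounded_linear_ip has_sum_infsum[OF assms(1)]] by (simp add: o_def)
  show "((\<lambda>i. ip (scale (ip f (\<omega> i)) (\<omega> i)) f)
      has_sum of_real (\<Sum>\<^sub>\<infinity>i\<in>J. (norm (ip f (\<omega> i)))\<^sup>2)) J"
    unfolding ip_frame_term
    using has_sum_bounded_linear[OF bounded_linear_of_real has_sum_infsum[OF assms(2)]] by (simp add: o_def)
qed

text \<open>The whole claim for a single Parseval frame; a weaving will take the role of
  \<open>\<omega>\<close>.\<close>

lemma parseval_partition: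
  fixes f :: 'a
  assumes frame: "frame_with_bounds ip I \<omega> 1 1" and "J \<subseteq> I"
  defines "s K \<equiv> \<Sum>\<^sub>\<infinity>i\<in>K. (norm (ip f (\<omega> i)))\<^sup>2"
    and "S K \<equiv> \<Sum>\<^sub>\<infinity>i\<in>K. scale (ip f (\<omega> i)) (\<omega> i)"
  shows "(\<lambda>i. scale (ip f (\<omega> i)) (\<omega> i)) summable_on J"
    and "s J + (norm (S (I - J)))\<^sup>2 = s (I - J) + (norm (S J))\<^sup>2"
    and "3 / 4 * (norm f)\<^sup>2 \<le> s (I - J) + (norm (S J))\<^sup>2"
proof -
  have s_summable: "(\<lambda>i. (norm (ip f (\<omega> i)))\<^sup>2) summable_on I" and sI: "s I = (norm f)\<^sup>2"
    using frame by (simp_all add: frame_with_bounds_def s_def order_antisym)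
  have expansion: "((\<lambda>i. scale (ip f (\<omega> i)) (\<omega> i)) has_sum f) I"
    by (rule parseval_expansion[OF frame])
  \<comment> \<open>By completeness, unconditional convergence passes to subfamilies.\<close>
  then have S_summable: "(\<lambda>i. scale (ip f (\<omega> i)) (\<omega> i)) summable_on K" if "K \<subseteq> I" for K
    using that has_sum_imp_summable summable_on_subset_banach[of _ I K] by blast
  then show "(\<lambda>i. scale (ip f (\<omega> i)) (\<omega> i)) summable_on J"
    using \<open>J \<subseteq> I\<close> .
  have disjoint: "J \<inter> (I - J) = {}"
    by auto
  have f: "S J + S (I - J) = f"
    using infsum_Un_disjoint[OF S_summable S_summable disjoint] infsumI[OF expansion] \<open>J \<subseteq> I\<close>
    by (simp add: S_def Un_absorb1)
  have sJ_summable: "(\<lambda>i. (norm (ip f (\<omega> i)))\<^sup>2) summable_on K" if "K \<subseteq> I" for K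
    using summable_on_subset_banach[OF s_summable that] .
  have sum: "s J + s (I - J) = (norm f)\<^sup>2"
    using infsum_Un_disjoint[OF sJ_summable sJ_summable disjoint] sI \<open>J \<subseteq> I\<close>
    by (simp add: s_def Un_absorb1)
  have ip: "ip (S J) f = of_real (s J)"
    unfolding S_def s_def using \<open>J \<subseteq> I\<close> by (intro ip_infsum_frame_terms S_summable sJ_summable)
  have "norm (S (I - J)) = norm (S J - f)"
    using f by (metis add_diff_cancel_left' norm_minus_commute)
  then show "s J + (norm (S (I - J)))\<^sup>2 = s (I - J) + (norm (S J))\<^sup>2"
    using norm_diff_sq_ip_real[OF ip] sum by simp
  have "s J \<le> norm (S J) * norm f"
    using norm_ip_le[of "S J" f] by (simp add: ip)
  \<comment> \<open>Completing the square absorbs the product of norms at the cost of a quarter of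
    the square of \<open>norm f\<close>, which leaves 3/4.\<close>
  moreover have "0 \<le> (norm (S J) - norm f / 2)\<^sup>2"
    by simp
  ultimately show "3 / 4 * (norm f)\<^sup>2 \<le> s (I - J) + (norm (S J))\<^sup>2"
    using sum by (simp add: power2_diff power_divide)
qed

end

theorem theorem5:
  fixes scale :: "'k::hilbert_scalar \<Rightarrow> 'a::banach \<Rightarrow> 'a"
    and ip :: "'a \<Rightarrow> 'a \<Rightarrow> 'k"
    and I :: "'i set"
    and \<phi> \<psi> :: "'i \<Rightarrow> 'a"
  assumes "hilbert_space scale ip"
    and "separable_space (euclidean :: 'a topology)"
    and "countable I"
    and "is_frame ip I \<phi>"
    and "is_frame ip I \<psi>"
    and "one_woven ip I \<phi> \<psi>"
  shows "\<forall>\<sigma>\<subseteq>I. \<forall>f.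
    (\<lambda>i. scale (ip f (\<phi> i)) (\<phi> i)) summable_on \<sigma> \<and>
    (\<lambda>i. scale (ip f (\<psi> i)) (\<psi> i)) summable_on (I - \<sigma>) \<and>
    (\<Sum>\<^sub>\<infinity>i\<in>\<sigma>. (norm (ip f (\<phi> i)))\<^sup>2)
        + (norm (\<Sum>\<^sub>\<infinity>i\<in>I - \<sigma>. scale (ip f (\<psi> i)) (\<psi> i)))\<^sup>2
      = (\<Sum>\<^sub>\<infinity>i\<in>I - \<sigma>. (norm (ip f (\<psi> i)))\<^sup>2)
        + (norm (\<Sum>\<^sub>\<infinity>i\<in>\<sigma>. scale (ip f (\<phi> i)) (\<phi> i)))\<^sup>2 \<and>
    (\<Sum>\<^sub>\<infinity>i\<in>I - \<sigma>. (norm (ip f (\<psi> i)))\<^sup>2)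
        + (norm (\<Sum>\<^sub>\<infinity>i\<in>\<sigma>. scale (ip f (\<phi> i)) (\<phi> i)))\<^sup>2
      \<ge> 3 / 4 * (norm f)\<^sup>2"
proof (intro allI impI)
  fix \<sigma> f
  assume \<sigma>: "\<sigma> \<subseteq> I"
  interpret hilbert_space scale ip by fact
  \<comment> \<open>The same \<open>\<sigma>\<close> serves as weaving set and as splitting set, so
    the two halves of the expansion involve only \<open>\<phi>\<close> and only
    \<open>\<psi>\<close>.\<close>
  define \<omega> where "\<omega> = weaving \<sigma> \<phi> \<psi>"
  have frame: "frame_with_bounds ip I \<omega> 1 1"
    using assms(6) \<sigma> by (simp add: woven_with_bounds_def \<omega>_def)
  have \<omega>: "\<omega> i = \<phi> i" if "i \<in> \<sigma>" for i
    using that by (simp add: \<omega>_def weaving_def)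
  have \<omega>': "\<omega> i = \<psi> i" if "i \<in> I - \<sigma>" for i
    using that by (simp add: \<omega>_def weaving_def)
  have eqs: "(\<Sum>\<^sub>\<infinity>i\<in>\<sigma>. (norm (ip f (\<omega> i)))\<^sup>2) = (\<Sum>\<^sub>\<infinity>i\<in>\<sigma>. (norm (ip f (\<phi> i)))\<^sup>2)"
    "(\<Sum>\<^sub>\<infinity>i\<in>I - \<sigma>. (norm (ip f (\<omega> i)))\<^sup>2) = (\<Sum>\<^sub>\<infinity>i\<in>I - \<sigma>. (norm (ip f (\<psi> i)))\<^sup>2)"
    "(\<Sum>\<^sub>\<infinity>i\<in>\<sigma>. scale (ip f (\<omega> i)) (\<omega> i)) = (\<Sum>\<^sub>\<infinity>i\<in>\<sigma>. scale (ip f (\<phi> i)) (\<phi> i))"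
    "(\<Sum>\<^sub>\<infinity>i\<in>I - \<sigma>. scale (ip f (\<omega> i)) (\<omega> i)) = (\<Sum>\<^sub>\<infinity>i\<in>I - \<sigma>. scale (ip f (\<psi> i)) (\<psi> i))"
    by (intro infsum_cong; simp add: \<omega> \<omega>')+
  have summable_eqs: "(\<lambda>i. scale (ip f (\<omega> i)) (\<omega> i)) summable_on \<sigma> \<longleftrightarrow>
      (\<lambda>i. scale (ip f (\<phi> i)) (\<phi> i)) summable_on \<sigma>"
    "(\<lambda>i. scale (ip f (\<omega> i)) (\<omega> i)) summable_on (I - \<sigma>) \<longleftrightarrow>
      (\<lambda>i. scale (ip f (\<psi> i)) (\<psi> i)) summable_on (I - \<sigma>)"
    by (intro summable_on_cong; simp add: \<omega> \<omega>')+
  show "(\<lambda>i. scale (ip f (\<phi> i)) (\<phi> i)) summable_on \<sigma> \<and>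
    (\<lambda>i. scale (ip f (\<psi> i)) (\<psi> i)) summable_on (I - \<sigma>) \<and>
    (\<Sum>\<^sub>\<infinity>i\<in>\<sigma>. (norm (ip f (\<phi> i)))\<^sup>2)
        + (norm (\<Sum>\<^sub>\<infinity>i\<in>I - \<sigma>. scale (ip f (\<psi> i)) (\<psi> i)))\<^sup>2
      = (\<Sum>\<^sub>\<infinity>i\<in>I - \<sigma>. (norm (ip f (\<psi> i)))\<^sup>2)
        + (norm (\<Sum>\<^sub>\<infinity>i\<in>\<sigma>. scale (ip f (\<phi> i)) (\<phi> i)))\<^sup>2 \<and>
    (\<Sum>\<^sub>\<infinity>i\<in>I - \<sigma>. (norm (ip f (\<psi> i)))\<^sup>2)
        + (norm (\<Sum>\<^sub>\<infinity>i\<in>\<sigma>. scale (ip f (\<phi> i)) (\<phi> i)))\<^sup>2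
      \<ge> 3 / 4 * (norm f)\<^sup>2"
    \<comment> \<open>The second instance, with \<open>J = I - \<sigma>\<close>, supplies
      summability of the \<open>\<psi>\<close> half.\<close>
    using parseval_partition[OF frame \<sigma>, of f] parseval_partition(1)[OF frame Diff_subset, of f \<sigma>]
    unfolding eqs summable_eqs by - (intro conjI)
qed

end
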